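(* Let $r\ge1$, let $p_1,\dots,p_r\ge5$ be distinct primes, $P=p_1\cdots p_r$ and $M=6P$. For every positive integer $n$, $$g_P\bigl(2(n+M)\bigr)-g_P(2n)=\kappa_P(n).$$ Equivalently, $g_P\bigl(2(n+6P)\bigr)-g_P(2n)=\kappa_P(n)$.
   Context: For a positive integer $n$, $g_P(2n)$ is the number of pairs $(h,k)\in\mathbb Z_{>0}^2$ with $h+k=2n$, $h\le k$, $\gcd(h,M)=\gcd(k,M)=1$. For $q\in\mathbb Z_{>0}$, $x\in\mathbb Z$, $\delta_q(x)=x-q\lfloor x/q\rfloor$. $\mathbf 1_{\{\cdot\}}$ denotes an indicator, $\varepsilon_i(n)=\mathbf 1_{\{\delta_{p_i}(n)=0\}}$, and $$\kappa_P(n)=\bigl(1+\mathbf 1_{\{\delta_3(n)=0\}}\bigr)\prod_{i=1}^r\bigl(p_i-2+\varepsilon_i(n)\bigr).$$ *)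

theory Defs
  imports Complex_Main "HOL-Computational_Algebra.Primes"
begin

definition pair_modulus :: "nat \<Rightarrow> nat" where
  "pair_modulus P = 6 * P"

text \<open>The second argument is the prescribed sum; the paper's \<open>g\<^sub>P(2n)\<close> is \<open>g P (2 * n)\<close>.\<close>

definition g :: "nat \<Rightarrow> nat \<Rightarrow> nat" where
  "g P m = card {(h :: nat, k :: nat). 0 < h \<and> 0 < k \<and> h + k = m \<and> h \<le> k \<and>
                  gcd h (pair_modulus P) = 1 \<and> gcd k (pair_modulus P) = 1}"

definition delta :: "nat \<Rightarrow> int \<Rightarrow> int" where
  "delta q x = x - int q * \<lfloor>real_of_int x / real q\<rfloor>"

definition eps :: "(nat \<Rightarrow> nat) \<Rightarrow> nat \<Rightarrow> nat \<Rightarrow> int" where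
  "eps p i n = of_bool (delta (p i) (int n) = 0)"

text \<open>
  The paper's \<open>\<kappa>\<^sub>P(n)\<close> for \<open>P = p 1 * \<dots> * p r\<close>. It takes the indexed family of primes in place of
  \<open>P\<close>, and is integer-valued so that the subtraction is not truncated.
\<close>

definition kappa :: "nat \<Rightarrow> (nat \<Rightarrow> nat) \<Rightarrow> nat \<Rightarrow> int" where
  "kappa r p n =
     (1 + of_bool (delta 3 (int n) = 0)) * (\<Prod>i = 1..r. int (p i) - 2 + eps p i n)"

end

(*
  A representation 2n = h + (2n - h) with h at most n is counted by g exactly when h and 2n - h are
  units modulo M. Replacing n by n + M changes 2n - h by a multiple of M, so it only enlarges the
  range of h by the block {n<..n+M}, a complete residue system modulo M. By the Chinese remainder
  theorem the number of admissible residues is a product over the primes q dividing M, where the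
  admissible residues modulo q are those different from 0 and from 2n.
*)

theory Submission
  imports Defs "HOL-Number_Theory.Cong"
begin

text \<open>The solutions of \<open>u + v = s\<close> in units of the ring of integers modulo
  \<open>m\<close>, each recorded by the least nonnegative residue of \<open>u\<close>. Integers are
  used so that \<open>s - t\<close> is not truncated when \<open>t\<close> exceeds
  \<open>s\<close>.\<close>

definition unit_splittings :: "int \<Rightarrow> int \<Rightarrow> int set" where
  "unit_splittings s m = {t \<in> {0..<m}. coprime t m \<and> coprime (s - t) m}"

lemma coprime_diff_mod_iff:
  fixes s t m :: int
  shows "coprime (s - t mod m) m \<longleftrightarrow> coprime (s - t) m"
  by (rule coprime_cong_cong_left) (simp add: cong_def mod_diff_right_eq)

lemma coprime_diff_add_multiple_iff:
  fixes s t m :: int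
  shows "coprime (s + c * m - t) m \<longleftrightarrow> coprime (s - t) m"
  by (rule coprime_cong_cong_left) (simp add: cong_iff_dvd_diff)

text \<open>The Chinese remainder map is a ring isomorphism: it respects \<open>s - t\<close>, and a
  residue modulo \<open>a * b\<close> is a unit exactly when both of its components are.\<close>

lemma bij_betw_unit_splittings_mult:
  fixes a b s :: int
  assumes "a > 0" "b > 0" "coprime a b"
  shows "bij_betw (\<lambda>t. (t mod a, t mod b))
           (unit_splittings s (a * b)) (unit_splittings s a \<times> unit_splittings s b)"
  unfolding bij_betw_def
proof
  show "inj_on (\<lambda>t. (t mod a, t mod b)) (unit_splittings s (a * b))"
  proof (intro inj_onI)
    fix x y assume xy: "x \<in> unit_splittings s (a * b)" "y \<in> unit_splittings s (a * b)"
      and "(x mod a, x mod b) = (y mod a, y mod b)"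
    then have "[x = y] (mod a * b)"
      using assms(3) by (intro coprime_cong_mult) (auto simp: cong_def)
    with xy show "x = y"
      by (auto simp: unit_splittings_def cong_def)
  qed
next
  show "(\<lambda>t. (t mod a, t mod b)) ` unit_splittings s (a * b)
      = unit_splittings s a \<times> unit_splittings s b"
  proof (intro equalityI subsetI)
    fix z assume "z \<in> (\<lambda>t. (t mod a, t mod b)) ` unit_splittings s (a * b)"
    then show "z \<in> unit_splittings s a \<times> unit_splittings s b"
      using assms by (auto simp: unit_splittings_def coprime_diff_mod_iff)
  next
    fix z assume z: "z \<in> unit_splittings s a \<times> unit_splittings s b"
    obtain x where x: "[x = fst z] (mod a)" "[x = snd z] (mod b)"
      using binary_chinese_remainder_int[OF assms(3)] by blast
    \<comment> \<open>The Chinese remainder solution is only fixed modulo \<open>a * b\<close>; this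
      picks its representative in \<open>{0..<a * b}\<close>.\<close>
    define t where "t = x mod (a * b)"
    have t: "t mod a = fst z" "t mod b = snd z"
      using x z by (auto simp: t_def cong_def mod_mod_cancel unit_splittings_def)
    have "coprime (t mod a) a" "coprime (s - t mod a) a"
      "coprime (t mod b) b" "coprime (s - t mod b) b"
      using z unfolding t by (auto simp: unit_splittings_def)
    then have "t \<in> unit_splittings s (a * b)"
      using assms(1,2) by (auto simp: unit_splittings_def coprime_diff_mod_iff t_def)
    with t show "z \<in> (\<lambda>t. (t mod a, t mod b)) ` unit_splittings s (a * b)"
      by (intro image_eqI[of _ _ t]) auto
  qed
qed

lemma card_unit_splittings_mult:
  fixes a b s :: int
  assumes "a > 0" "b > 0" "coprime a b"
  shows "card (unit_splittings s (a * b)) = card (unit_splittings s a) * card (unit_splittings s b)"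
  using bij_betw_same_card[OF bij_betw_unit_splittings_mult[OF assms]]
  by (simp add: card_cartesian_product)

text \<open>Modulo a prime the non-units form the single class 0, so only the residues 0 and
  \<open>s mod q\<close> are lost, and they coincide exactly when \<open>q dvd s\<close>. The case
  \<open>q = 2\<close> is included.\<close>

lemma card_unit_splittings_prime:
  fixes q s :: int
  assumes "prime q"
  shows "int (card (unit_splittings s q)) = q - 2 + of_bool (q dvd s)"
proof -
  have q: "q \<ge> 2"
    using assms by (rule prime_ge_2_int)
  have "unit_splittings s q = {0..<q} - {0, s mod q}"
  proof (intro set_eqI)
    fix t
    have "coprime x q \<longleftrightarrow> x mod q \<noteq> 0" for x
      using assms
      by (metis coprime_commute dvd_eq_mod_eq_0 prime_imp_coprime coprime_absorb_left not_prime_unit)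
    then have "t \<in> unit_splittings s q \<longleftrightarrow> t \<in> {0..<q} \<and> t mod q \<noteq> 0 \<and> (s - t) mod q \<noteq> 0"
      by (auto simp: unit_splittings_def)
    moreover have "(s - t) mod q = 0 \<longleftrightarrow> s mod q = t mod q"
      by (simp add: mod_eq_dvd_iff mod_eq_0_iff_dvd)
    ultimately show "t \<in> unit_splittings s q \<longleftrightarrow> t \<in> {0..<q} - {0, s mod q}"
      by (cases "t \<in> {0..<q}") auto
  qed
  \<comment> \<open>Both removed residues lie in \<open>{0..<q}\<close>, and
    \<open>q \<ge> 2\<close> prevents truncation of the natural-number difference.\<close>
  moreover have "card ({0..<q} - {0, s mod q}) = nat q - card {0, s mod q}"
    using q by (subst card_Diff_subset) auto
  moreover have "card {0, s mod q} = 2 - of_bool (q dvd s)"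
    by (auto simp: dvd_eq_mod_eq_0)
  ultimately show ?thesis
    using q by (auto simp: of_bool_def)
qed

lemma card_unit_splittings_prod:
  fixes q :: "'a \<Rightarrow> int" and s :: int
  assumes "finite A" "\<And>i. i \<in> A \<Longrightarrow> prime (q i)" "inj_on q A"
  shows "int (card (unit_splittings s (\<Prod>i\<in>A. q i))) = (\<Prod>i\<in>A. q i - 2 + of_bool (q i dvd s))"
  using assms
proof (induction A rule: finite_induct)
  case empty
  \<comment> \<open>Modulo 1 the only residue 0 is a unit, which matches the empty product.\<close>
  have "unit_splittings s 1 = {0}"
    by (auto simp: unit_splittings_def)
  then show ?case by simp
next
  case (insert i A)
  have "coprime (q i) (\<Prod>j\<in>A. q j)"
  proof (rule prod_coprime_right)
    fix j assume "j \<in> A"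
    with insert.hyps(2) insert.prems show "coprime (q i) (q j)"
      by (intro primes_coprime) auto
  qed
  moreover have "q i > 0" "(\<Prod>j\<in>A. q j) > 0"
    using insert.prems(1) by (simp_all add: prime_gt_0_int prod_pos)
  ultimately show ?case
    using insert by (simp add: card_unit_splittings_mult card_unit_splittings_prime)
qed

text \<open>Both coprimality conditions depend only on \<open>t mod m\<close>, and reduction modulo
  \<open>m\<close> is bijective on any \<open>m\<close> consecutive integers. The block is open on
  the left to continue a range ending at \<open>c\<close>.\<close>

lemma card_unit_splittings_block:
  fixes c m s :: int
  assumes "m > 0"
  shows "card {t \<in> {c<..c + m}. coprime t m \<and> coprime (s - t) m} = card (unit_splittings s m)"
proof (rule bij_betw_same_card[where f = "\<lambda>t. t mod m"], unfold bij_betw_def, intro conjI)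
  show "inj_on (\<lambda>t. t mod m) {t \<in> {c<..c + m}. coprime t m \<and> coprime (s - t) m}"
  proof (intro inj_onI)
    fix x y
    assume xy: "x \<in> {t \<in> {c<..c + m}. coprime t m \<and> coprime (s - t) m}"
      "y \<in> {t \<in> {c<..c + m}. coprime t m \<and> coprime (s - t) m}" "x mod m = y mod m"
    then have "m dvd x - y" "\<bar>x - y\<bar> < m"
      by (auto simp: mod_eq_dvd_iff)
    then show "x = y"
      using zdvd_imp_le[of m "\<bar>x - y\<bar>"] by force
  qed
  show "(\<lambda>t. t mod m) ` {t \<in> {c<..c + m}. coprime t m \<and> coprime (s - t) m} = unit_splittings s m"
  proof (intro equalityI subsetI)
    fix u assume "u \<in> (\<lambda>t. t mod m) ` {t \<in> {c<..c + m}. coprime t m \<and> coprime (s - t) m}"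
    then show "u \<in> unit_splittings s m"
      using assms by (auto simp: unit_splittings_def coprime_diff_mod_iff)
  next
    fix u assume u: "u \<in> unit_splittings s m"
    \<comment> \<open>The representative of \<open>u\<close> in \<open>{c<..c + m}\<close>: the
      offset from the first element \<open>c + 1\<close>, reduced modulo \<open>m\<close>.\<close>
    define t where "t = c + 1 + (u - c - 1) mod m"
    have "t mod m = u mod m"
      by (simp add: t_def mod_add_right_eq)
    then have tu: "t mod m = u"
      using u by (simp add: unit_splittings_def)
    have "(u - c - 1) mod m < m" "(u - c - 1) mod m \<ge> 0"
      using assms by simp_all
    then have "t \<in> {c<..c + m}"
      unfolding t_def by simp
    moreover have "coprime (t mod m) m" "coprime (s - t mod m) m"
      using u unfolding tu by (auto simp: unit_splittings_def)
    ultimately have "t \<in> {t \<in> {c<..c + m}. coprime t m \<and> coprime (s - t) m}"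
      using assms by (simp add: coprime_diff_mod_iff)
    then show "u \<in> (\<lambda>t. t mod m) ` {t \<in> {c<..c + m}. coprime t m \<and> coprime (s - t) m}"
      using tu by (intro image_eqI[of _ _ t]) auto
  qed
qed

text \<open>A pair is determined by its smaller entry \<open>h\<close>; given
  \<open>h + k = 2 * n\<close>, the condition \<open>h \<le> k\<close> becomes
  \<open>h \<le> n\<close>, and positivity of \<open>k\<close> then follows from that of
  \<open>h\<close>.\<close>

lemma g_even_eq_card:
  fixes P n :: nat
  defines "m \<equiv> int (6 * P)"
  shows "g P (2 * n) = card {t \<in> {0<..int n}. coprime t m \<and> coprime (2 * int n - t) m}"
  unfolding g_def
proof (rule bij_betw_same_card[where f = "\<lambda>(h, k). int h"])
  let ?A = "{(h, k). 0 < h \<and> 0 < k \<and> h + k = 2 * n \<and> h \<le> k \<and>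
    gcd h (pair_modulus P) = 1 \<and> gcd k (pair_modulus P) = 1}"
  let ?B = "{t \<in> {0<..int n}. coprime t m \<and> coprime (2 * int n - t) m}"
  have gcd_iff: "gcd h (pair_modulus P) = 1 \<longleftrightarrow> coprime (int h) m" for h
    by (simp only: m_def pair_modulus_def coprime_int_iff flip: coprime_iff_gcd_eq_1)
  show "bij_betw (\<lambda>(h, k). int h) ?A ?B"
    unfolding gcd_iff
  proof (rule bij_betw_byWitness[where f' = "\<lambda>t. (nat t, 2 * n - nat t)"], goal_cases)
    \<comment> \<open>Goals 3 and 4 are the inclusions of the two images; in the latter,
      \<open>t \<le> int n\<close> makes the natural subtraction exact.\<close>
    case 3
    have "coprime (2 * int n - int h) m" if "h + k = 2 * n" "coprime (int k) m" for h k
    proof -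
      have "2 * int n - int h = int k"
        using that(1) by linarith
      with that(2) show ?thesis by (simp only:)
    qed
    then show ?case by auto
  next
    case 4
    have "int (2 * n - nat t) = 2 * int n - t" if "0 < t" "t \<le> int n" for t
      using that by linarith
    then show ?case by auto
  qed auto
qed

lemma g_add_period:
  fixes P n :: nat
  assumes "P > 0"
  shows "g P (2 * (n + 6 * P)) = g P (2 * n) + card (unit_splittings (2 * int n) (int (6 * P)))"
proof -
  define m where "m = int (6 * P)"
  define S where "S I = {t \<in> I. coprime t m \<and> coprime (2 * int n - t) m}" for I
  have finite_S: "finite (S I)" if "finite I" for I
    unfolding S_def using that by simp
  have m: "m > 0"
    using assms by (simp add: m_def)
  \<comment> \<open>The prescribed sum grows by \<open>2 * m\<close>, which is invisible modulo
    \<open>m\<close>.\<close>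
  have "coprime (2 * int (n + 6 * P) - t) m \<longleftrightarrow> coprime (2 * int n - t) m" for t
    using coprime_diff_add_multiple_iff[of "2 * int n" 2 m t] by (simp add: m_def)
  then have "g P (2 * (n + 6 * P)) = card (S {0<..int n + m})"
    unfolding g_even_eq_card S_def m_def[symmetric] by (simp add: m_def)
  also have "S {0<..int n + m} = S {0<..int n} \<union> S {int n<..int n + m}"
    using m by (auto simp: S_def)
  also have "card \<dots> = card (S {0<..int n}) + card (S {int n<..int n + m})"
    by (rule card_Un_disjoint) (auto simp: finite_S, auto simp: S_def)
  also have "card (S {0<..int n}) = g P (2 * n)"
    unfolding g_even_eq_card S_def m_def ..
  also have "card (S {int n<..int n + m}) = card (unit_splittings (2 * int n) m)"
    unfolding S_def using m by (rule card_unit_splittings_block)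
  finally show ?thesis
    by (simp only: m_def)
qed

lemma delta_eq_mod: "delta q x = x mod int q"
  using floor_divide_of_int_eq[of x "int q", where ?'a = real]
  by (simp add: delta_def minus_mult_div_eq_mod)

text \<open>Bridges the local counts, which test divisibility of the sum \<open>2 * n\<close>, and
  \<open>kappa\<close>, which tests \<open>n\<close> itself.\<close>

lemma odd_prime_dvd_double_iff:
  fixes q x :: int
  assumes "prime q" "q > 2"
  shows "q dvd 2 * x \<longleftrightarrow> q dvd x"
  using assms zdvd_imp_le[of q 2] by (auto simp: prime_dvd_mult_iff)

lemma card_unit_splittings_eq_kappa:
  fixes p :: "nat \<Rightarrow> nat"
  assumes "\<And>i. i \<in> {1..r} \<Longrightarrow> prime (p i)" "\<And>i. i \<in> {1..r} \<Longrightarrow> p i \<ge> 5" "inj_on p {1..r}"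
  shows "int (card (unit_splittings (2 * int n) (int (6 * (\<Prod>i = 1..r. p i))))) = kappa r p n"
proof -
  let ?s = "2 * int n" and ?Q = "\<Prod>i = 1..r. int (p i)"
  have prime_p: "prime (int (p i))" "int (p i) > 3" if "i \<in> {1..r}" for i
    using assms(1,2)[OF that] by auto
  have prime3: "prime (3 :: int)" and prime2: "prime (2 :: int)"
    by simp_all
  have Q: "?Q > 0"
    using prime_p by (intro prod_pos) force
  have coprime_Q: "coprime q ?Q" if "prime q" "q \<le> 3" for q
  proof (rule prod_coprime_right)
    fix i assume "i \<in> {1..r}"
    from prime_p[OF this] that show "coprime q (int (p i))"
      by (intro primes_coprime) auto
  qed
  \<comment> \<open>Every \<open>p i\<close> exceeds 3, so the factors 2 and 3 of the modulus split
    off from \<open>?Q\<close>.\<close>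
  have "coprime 2 (3 * ?Q)" "coprime 3 ?Q"
    using coprime_Q[OF prime2] coprime_Q[OF prime3] by simp_all
  then have "card (unit_splittings ?s (2 * (3 * ?Q)))
      = card (unit_splittings ?s 2) * (card (unit_splittings ?s 3) * card (unit_splittings ?s ?Q))"
    using card_unit_splittings_mult[of 2 "3 * ?Q" ?s] card_unit_splittings_mult[of 3 ?Q ?s] Q
    by simp
  \<comment> \<open>The sum is even, so the two excluded residues modulo 2 coincide and only 1
    remains; hence \<open>kappa\<close> shows no factor for the prime 2.\<close>
  moreover have "int (card (unit_splittings ?s 2)) = 1"
    using card_unit_splittings_prime[OF prime2, of ?s] by simp
  moreover have "int (card (unit_splittings ?s 3)) = 1 + of_bool (delta 3 (int n) = 0)"
    using card_unit_splittings_prime[OF prime3, of ?s] odd_prime_dvd_double_iff[OF prime3, of "int n"]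
    by (simp add: delta_eq_mod mod_eq_0_iff_dvd)
  moreover have "int (card (unit_splittings ?s ?Q)) = (\<Prod>i = 1..r. int (p i) - 2 + eps p i n)"
  proof -
    have "inj_on (\<lambda>i. int (p i)) {1..r}"
      using assms(3) by (intro inj_onI) (simp only: of_nat_eq_iff inj_on_eq_iff)
    then have "int (card (unit_splittings ?s ?Q))
        = (\<Prod>i = 1..r. int (p i) - 2 + of_bool (int (p i) dvd ?s))"
      using prime_p by (intro card_unit_splittings_prod) auto
    also have "\<dots> = (\<Prod>i = 1..r. int (p i) - 2 + eps p i n)"
    proof (rule prod.cong[OF refl])
      fix i assume "i \<in> {1..r}"
      from prime_p[OF this] have "int (p i) dvd ?s \<longleftrightarrow> int (p i) dvd int n"
        by (intro odd_prime_dvd_double_iff) auto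
      then show "int (p i) - 2 + of_bool (int (p i) dvd ?s) = int (p i) - 2 + eps p i n"
        by (simp only: eps_def delta_eq_mod mod_eq_0_iff_dvd)
    qed
    finally show ?thesis .
  qed
  moreover have "int (6 * (\<Prod>i = 1..r. p i)) = 2 * (3 * ?Q)"
    by simp
  ultimately show ?thesis
    by (simp only: kappa_def of_nat_mult mult_1)
qed

theorem theorem4p4:
  fixes r :: nat and p :: "nat \<Rightarrow> nat" and P M n :: nat
  assumes "r \<ge> 1"
    and "\<And>i. i \<in> {1..r} \<Longrightarrow> prime (p i)"
    and "\<And>i. i \<in> {1..r} \<Longrightarrow> p i \<ge> 5"
    and "inj_on p {1..r}"
    and "P = (\<Prod>i = 1..r. p i)"
    and "M = 6 * P"
    and "n > 0"
  shows "int (g P (2 * (n + M))) - int (g P (2 * n)) = kappa r p n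
       \<and> int (g P (2 * (n + 6 * P))) - int (g P (2 * n)) = kappa r p n"
proof -
  have "P > 0"
    unfolding assms(5) using assms(2) by (intro prod_pos) (simp add: prime_gt_0_nat)
  then have "int (g P (2 * (n + 6 * P))) - int (g P (2 * n)) = kappa r p n"
    using card_unit_splittings_eq_kappa[OF assms(2-4), of n, folded assms(5)] g_add_period by simp
  then show ?thesis
    by (simp add: assms(6))
qed

end
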